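(* Let $M\ge1$, $B_c>0$, $P>0$, and $\Gamma_{1,m}\ge\Gamma_{2,m}>0$ for $m=1,\dots,M$. Consider the problem over $\boldsymbol q=(q_1,\dots,q_M)$ $$\max_{\boldsymbol q}\ \min_{m=1,\dots,M} f_m^{\mathrm{MMF}\star}(q_m)\quad\text{s.t.}\quad \sum_{m=1}^M q_m\le P,\ \ q_m\ge0\ \forall m,$$ where $$f_m^{\mathrm{MMF}\star}(q_m)=B_c\log\left(\frac{\Gamma_{2,m}-\Gamma_{1,m}+\sqrt{(\Gamma_{1,m}+\Gamma_{2,m})^2+4\Gamma_{1,m}\Gamma_{2,m}^2q_m}}{2\Gamma_{2,m}}\right).$$ The optimal solution is given by $$q_m^\star=\frac{(Z(\lambda)\Gamma_{2,m}+\Gamma_{1,m})(Z(\lambda)-1)}{\Gamma_{1,m}\Gamma_{2,m}},\qquad m=1,\dots,M,$$ where $$Z(\lambda)=X+\sqrt{X^2+\frac{B_c}{2\lambda\sum_{m=1}^M 1/\Gamma_{1,m}}},\qquad X=\frac{\sum_{m=1}^M(\Gamma_{2,m}-\Gamma_{1,m})/(\Gamma_{1,m}\Gamma_{2,m})}{4\sum_{m=1}^M1/\Gamma_{1,m}},$$ and $\lambda>0$ is chosen such that $\sum_{m=1}^M q_m^\star=P$.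
   Context: $\log$ is the base-2 logarithm. Here $q_m$ is the power budget of channel $m$ in a downlink NOMA system with two users per channel, $P$ the total power, $B_c$ the bandwidth of each channel, $\Gamma_{l,m}$ the channel-to-noise ratio of user $l$ on channel $m$; $f_m^{\mathrm{MMF}\star}(q_m)$ is the optimal maximin rate on channel $m$ with budget $q_m$. *)

theory Defs
  imports Complex_Main
begin

text \<open>
  Channels are the indices \<open>m \<in> {1..M}\<close>, and \<open>\<Gamma> l m\<close> is the channel-to-noise ratio of user
  \<open>l \<in> {1, 2}\<close> on channel \<open>m\<close>. A power allocation is a function \<open>q :: nat \<Rightarrow> real\<close> of which
  only the values on \<open>{1..M}\<close> matter.
\<close>

definition f_MMF :: "real \<Rightarrow> (nat \<Rightarrow> nat \<Rightarrow> real) \<Rightarrow> nat \<Rightarrow> real \<Rightarrow> real" where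
  "f_MMF Bc \<Gamma> m x =
     Bc * log 2 ((\<Gamma> 2 m - \<Gamma> 1 m + sqrt ((\<Gamma> 1 m + \<Gamma> 2 m)\<^sup>2 + 4 * \<Gamma> 1 m * (\<Gamma> 2 m)\<^sup>2 * x))
                 / (2 * \<Gamma> 2 m))"

definition min_rate :: "real \<Rightarrow> (nat \<Rightarrow> nat \<Rightarrow> real) \<Rightarrow> nat \<Rightarrow> (nat \<Rightarrow> real) \<Rightarrow> real" where
  "min_rate Bc \<Gamma> M q = Min ((\<lambda>m. f_MMF Bc \<Gamma> m (q m)) ` {1..M})"

definition feasible :: "nat \<Rightarrow> real \<Rightarrow> (nat \<Rightarrow> real) \<Rightarrow> bool" where
  "feasible M P q \<longleftrightarrow> (\<Sum>m=1..M. q m) \<le> P \<and> (\<forall>m\<in>{1..M}. q m \<ge> 0)"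

definition X_val :: "(nat \<Rightarrow> nat \<Rightarrow> real) \<Rightarrow> nat \<Rightarrow> real" where
  "X_val \<Gamma> M = (\<Sum>m=1..M. (\<Gamma> 2 m - \<Gamma> 1 m) / (\<Gamma> 1 m * \<Gamma> 2 m)) / (4 * (\<Sum>m=1..M. 1 / \<Gamma> 1 m))"

definition Z_val :: "real \<Rightarrow> (nat \<Rightarrow> nat \<Rightarrow> real) \<Rightarrow> nat \<Rightarrow> real \<Rightarrow> real" where
  "Z_val Bc \<Gamma> M lam =
     X_val \<Gamma> M + sqrt ((X_val \<Gamma> M)\<^sup>2 + Bc / (2 * lam * (\<Sum>m=1..M. 1 / \<Gamma> 1 m)))"

definition q_star :: "real \<Rightarrow> (nat \<Rightarrow> nat \<Rightarrow> real) \<Rightarrow> nat \<Rightarrow> real \<Rightarrow> nat \<Rightarrow> real" where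
  "q_star Bc \<Gamma> M lam m =
     (Z_val Bc \<Gamma> M lam * \<Gamma> 2 m + \<Gamma> 1 m) * (Z_val Bc \<Gamma> M lam - 1) / (\<Gamma> 1 m * \<Gamma> 2 m)"

end

theory Submission
  imports Defs
begin

text \<open>
  The allocation \<open>q_star\<close> is the inverse of the rate functions: it gives every channel the common
  rate \<open>Bc * log 2 (Z_val Bc \<Gamma> M lam)\<close>.  The rate functions are strictly increasing, so an
  allocation whose smallest rate is at least as large spends at least as much power on every
  channel; as \<open>q_star\<close> already exhausts the budget, the two allocations agree.
  Since \<open>X_val \<Gamma> M \<le> 0\<close>, the map \<open>lam \<mapsto> Z_val Bc \<Gamma> M lam\<close> takes every positive
  value, so \<open>lam\<close> exists by the intermediate value theorem applied to the total power as a
  function of the common rate.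
\<close>

text \<open>This is \<open>q_star\<close> with \<open>Z_val Bc \<Gamma> M lam\<close> replaced by a
  free variable \<open>z\<close>. Being polynomial in \<open>z\<close>, its sign and continuity can
  be studied without reference to \<open>lam\<close>.\<close>

definition channel_power :: "(nat \<Rightarrow> nat \<Rightarrow> real) \<Rightarrow> nat \<Rightarrow> real \<Rightarrow> real" where
  "channel_power \<Gamma> m z = (z * \<Gamma> 2 m + \<Gamma> 1 m) * (z - 1) / (\<Gamma> 1 m * \<Gamma> 2 m)"

lemma q_star_eq: "q_star Bc \<Gamma> M lam m = channel_power \<Gamma> m (Z_val Bc \<Gamma> M lam)"
  by (simp add: q_star_def channel_power_def)

text \<open>Substituting this power turns the radicand into a perfect square. Its base is
  nonnegative because \<open>\<Gamma> 2 m \<le> \<Gamma> 1 m\<close> and \<open>0 \<le> z\<close>,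
  so the root removes the square.\<close>

lemma f_MMF_channel_power:
  assumes "\<Gamma> 2 m \<le> \<Gamma> 1 m" "0 < \<Gamma> 2 m" "0 \<le> z"
  shows "f_MMF Bc \<Gamma> m (channel_power \<Gamma> m z) = Bc * log 2 z"
proof -
  let ?a = "\<Gamma> 1 m" and ?b = "\<Gamma> 2 m"
  have pos: "?a > 0" "?b > 0" using assms by auto
  have "(?a + ?b)\<^sup>2 + 4 * ?a * ?b\<^sup>2 * channel_power \<Gamma> m z
      = (?a + ?b)\<^sup>2 + 4 * ?b * ((z * ?b + ?a) * (z - 1))"
    using pos by (simp add: channel_power_def power2_eq_square)
  also have "\<dots> = (2 * ?b * z + ?a - ?b)\<^sup>2"
    by (simp add: power2_eq_square algebra_simps)
  finally have sq: "(?a + ?b)\<^sup>2 + 4 * ?a * ?b\<^sup>2 * channel_power \<Gamma> m z = (2 * ?b * z + ?a - ?b)\<^sup>2" .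
  have "0 \<le> ?b * z"
    using assms by simp
  then have "0 \<le> 2 * ?b * z + ?a - ?b"
    using assms(1) by linarith
  then have "sqrt ((?a + ?b)\<^sup>2 + 4 * ?a * ?b\<^sup>2 * channel_power \<Gamma> m z) = 2 * ?b * z + ?a - ?b"
    unfolding sq by (rule real_sqrt_unique[OF refl])
  then show ?thesis
    using pos by (simp add: f_MMF_def)
qed

lemma f_MMF_strict_mono:
  assumes "0 < Bc" "0 < \<Gamma> 1 m" "0 < \<Gamma> 2 m" "0 \<le> x" "x < y"
  shows "f_MMF Bc \<Gamma> m x < f_MMF Bc \<Gamma> m y"
proof -
  let ?a = "\<Gamma> 1 m" and ?b = "\<Gamma> 2 m"
  let ?s = "\<lambda>x. sqrt ((?a + ?b)\<^sup>2 + 4 * ?a * ?b\<^sup>2 * x)"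
  \<comment> \<open>For \<open>0 \<le> x\<close> the root is at least \<open>?a + ?b\<close>, so the
    numerator inside the logarithm is at least \<open>2 * ?b\<close> and the logarithm is strictly
    increasing there.\<close>
  have "?a + ?b = sqrt ((?a + ?b)\<^sup>2)"
    using assms by simp
  also have "\<dots> \<le> ?s x"
    using assms by (intro real_sqrt_le_mono) simp
  finally have "0 < ?b - ?a + ?s x"
    using assms by linarith
  moreover have "?s x < ?s y"
    using assms by simp
  ultimately show ?thesis
    using assms unfolding f_MMF_def
    by (intro mult_strict_left_mono) (auto intro!: log_less divide_strict_right_mono divide_pos_pos)
qed

lemma channel_power_nonneg:
  assumes "0 < \<Gamma> 1 m" "0 < \<Gamma> 2 m" "1 \<le> z"
  shows "0 \<le> channel_power \<Gamma> m z"
  using assms by (simp add: channel_power_def)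

lemma channel_power_nonpos:
  assumes "0 < \<Gamma> 1 m" "0 < \<Gamma> 2 m" "0 \<le> z" "z \<le> 1"
  shows "channel_power \<Gamma> m z \<le> 0"
  using assms unfolding channel_power_def
  by (intro divide_nonpos_pos mult_nonneg_nonpos) auto

text \<open>At this \<open>z\<close> the factor \<open>z - 1\<close> is
  \<open>P * \<Gamma> 2 m\<close>, and the other factor is at least \<open>\<Gamma> 1 m\<close>. It
  supplies the upper endpoint for the intermediate value theorem: a single channel already absorbs
  the budget.\<close>

lemma le_channel_power:
  assumes "0 < \<Gamma> 1 m" "0 < \<Gamma> 2 m" "0 \<le> P"
  shows "P \<le> channel_power \<Gamma> m (1 + P * \<Gamma> 2 m)"
proof -
  have "P = \<Gamma> 1 m * (P * \<Gamma> 2 m) / (\<Gamma> 1 m * \<Gamma> 2 m)"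
    using assms by simp
  also have "\<dots> \<le> channel_power \<Gamma> m (1 + P * \<Gamma> 2 m)"
    using assms unfolding channel_power_def
    by (intro divide_right_mono mult_mono) auto
  finally show ?thesis .
qed

lemma total_power_attained:
  assumes "finite I" "i \<in> I" "0 \<le> P"
    and pos: "\<And>m. m \<in> I \<Longrightarrow> 0 < \<Gamma> 1 m \<and> 0 < \<Gamma> 2 m"
  obtains z where "1 \<le> z" "(\<Sum>m\<in>I. channel_power \<Gamma> m z) = P"
proof -
  let ?S = "\<lambda>z. \<Sum>m\<in>I. channel_power \<Gamma> m z" and ?w = "1 + P * \<Gamma> 2 i"
  have w: "1 \<le> ?w" using \<open>0 \<le> P\<close> pos[OF \<open>i \<in> I\<close>] by simp
  have "?S 1 \<le> P" using \<open>0 \<le> P\<close> by (simp add: channel_power_def)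
  moreover have "P \<le> ?S ?w"
  proof -
    have "P \<le> channel_power \<Gamma> i ?w"
      using assms pos[OF \<open>i \<in> I\<close>] by (intro le_channel_power) auto
    also have "\<dots> \<le> ?S ?w"
      using assms w by (intro member_le_sum) (auto intro: channel_power_nonneg)
    finally show ?thesis .
  qed
  moreover have "continuous_on {1..?w} ?S"
    unfolding channel_power_def divide_inverse by (intro continuous_intros)
  ultimately obtain z where "1 \<le> z" "?S z = P"
    using IVT'[of ?S 1 P ?w] w by blast
  with that show ?thesis by blast
qed

context
  fixes M :: nat and Bc :: real and \<Gamma> :: "nat \<Rightarrow> nat \<Rightarrow> real"
  assumes M: "M \<ge> 1" and Bc: "Bc > 0"
    and \<Gamma>: "\<And>m. m \<in> {1..M} \<Longrightarrow> \<Gamma> 1 m \<ge> \<Gamma> 2 m \<and> \<Gamma> 2 m > 0"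
begin

lemma \<Gamma>_pos:
  assumes "m \<in> {1..M}"
  shows "0 < \<Gamma> 1 m" "0 < \<Gamma> 2 m"
  using \<Gamma>[OF assms] by auto

lemma sum_inverse_\<Gamma>_pos: "0 < (\<Sum>m=1..M. 1 / \<Gamma> 1 m)"
  using M \<Gamma>_pos by (intro sum_pos) auto

lemma X_val_nonpos: "X_val \<Gamma> M \<le> 0"
  unfolding X_val_def using sum_inverse_\<Gamma>_pos
  by (intro divide_nonpos_pos sum_nonpos mult_pos_pos) (use \<Gamma> \<Gamma>_pos in simp_all)

lemma Z_val_pos:
  assumes "0 < lam"
  shows "0 < Z_val Bc \<Gamma> M lam"
proof -
  \<comment> \<open>The added term is positive, so the root strictly exceeds the absolute value of
    \<open>X_val \<Gamma> M\<close> and outweighs its negative sign.\<close>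
  have "\<bar>X_val \<Gamma> M\<bar> = sqrt ((X_val \<Gamma> M)\<^sup>2)"
    by simp
  also have "\<dots> < sqrt ((X_val \<Gamma> M)\<^sup>2 + Bc / (2 * lam * (\<Sum>m=1..M. 1 / \<Gamma> 1 m)))"
    using assms Bc sum_inverse_\<Gamma>_pos by (intro real_sqrt_less_mono) simp
  finally show ?thesis
    unfolding Z_val_def by linarith
qed

lemma Z_val_attained:
  assumes "0 < z"
  obtains lam where "0 < lam" "Z_val Bc \<Gamma> M lam = z"
proof -
  let ?X = "X_val \<Gamma> M" and ?A = "\<Sum>m=1..M. 1 / \<Gamma> 1 m"
  have pos: "0 < z * (z - 2 * ?X)"
    using assms X_val_nonpos by (intro mult_pos_pos) auto
  \<comment> \<open>\<open>Z_val Bc \<Gamma> M lam\<close> is the positive root \<open>z\<close> of \<open>z\<^sup>2 - 2 * X * z = Bc / (2 * lam * A)\<close>.\<close>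
  define lam where "lam = Bc / (2 * ?A * (z * (z - 2 * ?X)))"
  have "Bc / (2 * lam * ?A) = z * (z - 2 * ?X)"
    using pos Bc sum_inverse_\<Gamma>_pos unfolding lam_def by simp
  then have "?X\<^sup>2 + Bc / (2 * lam * ?A) = (z - ?X)\<^sup>2"
    by (simp add: power2_eq_square algebra_simps)
  \<comment> \<open>The root of this square is \<open>z - ?X\<close> because
    \<open>?X \<le> 0 < z\<close>.\<close>
  then have "Z_val Bc \<Gamma> M lam = z"
    using assms X_val_nonpos by (simp add: Z_val_def)
  moreover have "0 < lam"
    unfolding lam_def using pos Bc sum_inverse_\<Gamma>_pos by (intro divide_pos_pos mult_pos_pos[OF _ pos]) auto
  ultimately show ?thesis using that by blast
qed

lemma le_min_rate_iff: "r \<le> min_rate Bc \<Gamma> M q \<longleftrightarrow> (\<forall>m\<in>{1..M}. r \<le> f_MMF Bc \<Gamma> m (q m))"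
  unfolding min_rate_def using M by (subst Min_ge_iff) auto

lemma min_rate_cong:
  assumes "\<forall>m\<in>{1..M}. q m = q' m"
  shows "min_rate Bc \<Gamma> M q = min_rate Bc \<Gamma> M q'"
  unfolding min_rate_def using assms by (intro arg_cong[where f = Min] image_cong) auto

lemma is_arg_max_min_rate_iff:
  assumes "1 \<le> z" and total: "(\<Sum>m=1..M. channel_power \<Gamma> m z) = P"
  shows "is_arg_max (min_rate Bc \<Gamma> M) (feasible M P) q \<longleftrightarrow>
    (\<forall>m\<in>{1..M}. q m = channel_power \<Gamma> m z)"
proof -
  let ?p = "\<lambda>m. channel_power \<Gamma> m z"
  have feas: "feasible M P ?p"
    using total \<open>1 \<le> z\<close> \<Gamma>_pos by (auto simp: feasible_def intro!: channel_power_nonneg)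
  have rate: "f_MMF Bc \<Gamma> m (?p m) = Bc * log 2 z" if "m \<in> {1..M}" for m
    using \<Gamma>[OF that] \<open>1 \<le> z\<close> by (intro f_MMF_channel_power) auto
  have min_rate: "min_rate Bc \<Gamma> M ?p = Bc * log 2 z"
  proof -
    have "(\<lambda>m. f_MMF Bc \<Gamma> m (?p m)) ` {1..M} = (\<lambda>m. Bc * log 2 z) ` {1..M}"
      using rate by (intro image_cong) auto
    then show ?thesis
      unfolding min_rate_def using M by simp
  qed
  \<comment> \<open>This serves both directions below. A maximiser is at least as good as the
    feasible \<open>?p\<close>, hence agrees with it. Conversely, a feasible allocation better than
    \<open>?p\<close> would agree with \<open>?p\<close> on all channels and so have the same
    minimum rate.\<close>
  have unique: "\<forall>m\<in>{1..M}. q m = ?p m"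
    if q: "feasible M P q" and le: "min_rate Bc \<Gamma> M ?p \<le> min_rate Bc \<Gamma> M q" for q
  proof -
    have ge: "?p m \<le> q m" if m: "m \<in> {1..M}" for m
    proof (rule ccontr)
      assume "\<not> ?p m \<le> q m"
      then have "f_MMF Bc \<Gamma> m (q m) < f_MMF Bc \<Gamma> m (?p m)"
        using m q Bc \<Gamma>_pos[OF m] by (intro f_MMF_strict_mono) (auto simp: feasible_def)
      then show False
        using le m rate[OF m] unfolding min_rate le_min_rate_iff by fastforce
    qed
    then have "(\<Sum>m=1..M. ?p m) \<le> (\<Sum>m=1..M. q m)"
      by (rule sum_mono)
    then have "(\<Sum>m=1..M. ?p m) = (\<Sum>m=1..M. q m)"
      using q total by (simp add: feasible_def)
    then show ?thesis
      using sum_mono_inv[of ?p "{1..M}" q] ge by fastforce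
  qed
  show ?thesis
  proof
    assume "is_arg_max (min_rate Bc \<Gamma> M) (feasible M P) q"
    then show "\<forall>m\<in>{1..M}. q m = ?p m"
      using feas by (intro unique) (auto simp: is_arg_max_def not_less)
  next
    assume eq: "\<forall>m\<in>{1..M}. q m = ?p m"
    have "feasible M P q"
      using feas eq by (simp add: feasible_def)
    moreover have "\<not> min_rate Bc \<Gamma> M q < min_rate Bc \<Gamma> M q'" if "feasible M P q'" for q'
      using unique[OF that] min_rate_cong[OF eq] min_rate_cong[of q' ?p] by linarith
    ultimately show "is_arg_max (min_rate Bc \<Gamma> M) (feasible M P) q"
      by (auto simp: is_arg_max_def)
  qed
qed

end

theorem theorem1:
  fixes M :: nat and Bc P :: real and \<Gamma> :: "nat \<Rightarrow> nat \<Rightarrow> real"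
  assumes "M \<ge> 1" and "Bc > 0" and "P > 0"
    and "\<And>m. m \<in> {1..M} \<Longrightarrow> \<Gamma> 1 m \<ge> \<Gamma> 2 m \<and> \<Gamma> 2 m > 0"
  shows "(\<exists>lam>0. (\<Sum>m=1..M. q_star Bc \<Gamma> M lam m) = P) \<and>
         (\<forall>lam>0. (\<Sum>m=1..M. q_star Bc \<Gamma> M lam m) = P \<longrightarrow>
            (\<forall>q. is_arg_max (min_rate Bc \<Gamma> M) (feasible M P) q \<longleftrightarrow>
                 (\<forall>m\<in>{1..M}. q m = q_star Bc \<Gamma> M lam m)))"
proof (intro conjI allI impI)
  obtain z where z: "1 \<le> z" "(\<Sum>m=1..M. channel_power \<Gamma> m z) = P"
    using total_power_attained[of "{1..M}" 1 P \<Gamma>] assms \<Gamma>_pos[where \<Gamma> = \<Gamma>, OF assms(1,2,4)] by auto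
  then have "0 < z" by simp
  then obtain lam where "0 < lam" "Z_val Bc \<Gamma> M lam = z"
    using Z_val_attained[where \<Gamma> = \<Gamma>, OF assms(1,2,4)] by metis
  then show "\<exists>lam>0. (\<Sum>m=1..M. q_star Bc \<Gamma> M lam m) = P"
    using z by (auto simp: q_star_eq)
next
  fix lam q
  assume lam: "0 < lam" and total: "(\<Sum>m=1..M. q_star Bc \<Gamma> M lam m) = P"
  \<comment> \<open>The given \<open>lam\<close> is arbitrary, so feasibility of
    \<open>q_star\<close> must come from the budget equation: with \<open>Z_val\<close> in
    \<open>(0, 1)\<close> no channel gets positive power, and the total could not be
    \<open>P > 0\<close>.\<close>
  have "1 \<le> Z_val Bc \<Gamma> M lam"
  proof (rule ccontr)
    assume "\<not> 1 \<le> Z_val Bc \<Gamma> M lam"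
    then have "(\<Sum>m=1..M. q_star Bc \<Gamma> M lam m) \<le> 0"
      using Z_val_pos[where \<Gamma> = \<Gamma>, OF assms(1,2,4) lam] \<Gamma>_pos[where \<Gamma> = \<Gamma>, OF assms(1,2,4)]
      by (intro sum_nonpos) (auto simp: q_star_eq intro!: channel_power_nonpos)
    with total \<open>P > 0\<close> show False by simp
  qed
  then show "is_arg_max (min_rate Bc \<Gamma> M) (feasible M P) q \<longleftrightarrow>
      (\<forall>m\<in>{1..M}. q m = q_star Bc \<Gamma> M lam m)"
    using total unfolding q_star_eq by (intro is_arg_max_min_rate_iff[where \<Gamma> = \<Gamma>, OF assms(1,2,4)])
qed

end
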